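(* Let $T>0$, $I=[-T,T]$, and let $m>0$ with $m\neq(k\pi/T)^2$ for all $k\in\mathbb{N}$. Let $G_m$ be the Green's function of the periodic problem $v''(t)+m\,v(-t)=\sigma(t)$ a.e. $t\in I$, $v(T)=v(-T)$, $v'(T)=v'(-T)$. Then $G_m$ is positive on $I\times I$ if, and only if, $m\in(0,\lambda_1)$, where $\lambda_1=\left(\frac{\pi}{2T}\right)^2$ is the smallest positive Dirichlet eigenvalue of the problem $$z''(t)=-m\,z(-t),\quad t\in I,\qquad z(-T)=z(T)=0.$$
   Context: A solution of the periodic problem, for $\sigma\in\mathcal{L}^1(I)$, is a function $v\in C^1(I)$ with $v'$ absolutely continuous on $I$ that satisfies the differential equation a.e. on $I$ and the boundary conditions. The Green's function is the continuous kernel $G_m:I\times I\to\mathbb{R}$ such that for every $\sigma\in\mathcal{L}^1(I)$ the unique solution is $v(t)=\int_{-T}^{T}G_m(t,s)\sigma(s)\,ds$. Positive means $>0$ at every point. A Dirichlet eigenvalue of the problem for $z$ is a value of the parameter $m$ for which that problem has a nontrivial solution. *)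

theory Defs
  imports "HOL-Analysis.Analysis"
begin

text \<open>Functions on an interval are total functions on the reals whose values outside the
  interval are irrelevant: at an end point the derivative is the one-sided one.\<close>

(* The library constant absolutely_continuous relates measures, not functions.
   Degenerate intervals a k = b k are allowed; they contribute nothing to either sum. *)
definition abs_continuous_on :: "real set \<Rightarrow> (real \<Rightarrow> real) \<Rightarrow> bool" where
  "abs_continuous_on S f \<longleftrightarrow>
     (\<forall>\<epsilon>>0. \<exists>\<delta>>0. \<forall>(n::nat) a b.
        (\<forall>k<n. a k \<le> b k \<and> {a k..b k} \<subseteq> S) \<and>
        disjoint_family_on (\<lambda>k. {a k<..<b k}) {..<n} \<and>
        (\<Sum>k<n. b k - a k) < \<delta>
        \<longrightarrow> (\<Sum>k<n. \<bar>f (b k) - f (a k)\<bar>) < \<epsilon>)"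

definition periodic_solution ::
  "real \<Rightarrow> real \<Rightarrow> (real \<Rightarrow> real) \<Rightarrow> (real \<Rightarrow> real) \<Rightarrow> bool" where
  "periodic_solution T m \<sigma> v \<longleftrightarrow>
     (\<exists>v'. (\<forall>t\<in>{-T..T}. (v has_real_derivative v' t) (at t within {-T..T})) \<and>
           continuous_on {-T..T} v' \<and>
           abs_continuous_on {-T..T} v' \<and>
           (AE t in lebesgue_on {-T..T}.
              \<exists>w. (v' has_real_derivative w) (at t within {-T..T}) \<and> w + m * v (- t) = \<sigma> t) \<and>
           v T = v (- T) \<and> v' T = v' (- T))"

definition is_greens_function :: "real \<Rightarrow> real \<Rightarrow> (real \<Rightarrow> real \<Rightarrow> real) \<Rightarrow> bool" where
  "is_greens_function T m G \<longleftrightarrow>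
     continuous_on ({-T..T} \<times> {-T..T}) (\<lambda>(t, s). G t s) \<and>
     (\<forall>\<sigma>. \<sigma> absolutely_integrable_on {-T..T} \<longrightarrow>
        periodic_solution T m \<sigma> (\<lambda>t. LINT s:{-T..T}|lebesgue. G t s * \<sigma> s) \<and>
        (\<forall>v. periodic_solution T m \<sigma> v \<longrightarrow>
           (\<forall>t\<in>{-T..T}. v t = (LINT s:{-T..T}|lebesgue. G t s * \<sigma> s))))"

definition dirichlet_solution :: "real \<Rightarrow> real \<Rightarrow> (real \<Rightarrow> real) \<Rightarrow> bool" where
  "dirichlet_solution T m z \<longleftrightarrow>
     (\<exists>z'. (\<forall>t\<in>{-T..T}. (z has_real_derivative z' t) (at t within {-T..T})) \<and>
           (\<forall>t\<in>{-T..T}. (z' has_real_derivative - m * z (- t)) (at t within {-T..T})) \<and>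
           z (- T) = 0 \<and> z T = 0)"

definition dirichlet_eigenvalue :: "real \<Rightarrow> real \<Rightarrow> bool" where
  "dirichlet_eigenvalue T m \<longleftrightarrow>
     (\<exists>z. dirichlet_solution T m z \<and> (\<exists>t\<in>{-T..T}. z t \<noteq> 0))"

definition is_smallest_positive_dirichlet_eigenvalue :: "real \<Rightarrow> real \<Rightarrow> bool" where
  "is_smallest_positive_dirichlet_eigenvalue T l \<longleftrightarrow>
     0 < l \<and> dirichlet_eigenvalue T l \<and> (\<forall>\<mu>>0. dirichlet_eigenvalue T \<mu> \<longrightarrow> l \<le> \<mu>)"

end

theory Submission
  imports Defs
begin

text \<open>The equation decouples on the even and the odd part of a solution: the even part \<open>e\<close> solves
  \<open>e'' + m e = \<sigma>\<^sub>e\<close> on \<open>[0, T]\<close> with Neumann conditions, the odd part \<open>o\<close> solves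
  \<open>o'' - m o = \<sigma>\<^sub>o\<close> with Dirichlet conditions. With \<open>w = sqrt m\<close>, this gives
  \<open>G(t, s) = (N + D) / 2\<close> and \<open>G(t, -s) = (N - D) / 2\<close> for \<open>t, s \<ge> 0\<close>, where
  \<open>N = cos (w min) cos (w (T - max)) / (w sin (w T))\<close> and
  \<open>D = - sinh (w min) sinh (w (T - max)) / (w sinh (w T))\<close>.
  For \<open>w T < \<pi>/2\<close> one has \<open>\<bar>D\<bar> < N\<close>; for \<open>w T \<ge> \<pi>/2\<close>, \<open>N\<close> vanishes at \<open>t = 0\<close>, \<open>s = T - \<pi>/(2 w)\<close>.\<close>

section \<open>Absolute continuity, parity extension and folding of integrals\<close>

lemma lipschitz_imp_abs_continuous_on:
  assumes "\<And>x y. \<lbrakk>x \<in> S; y \<in> S\<rbrakk> \<Longrightarrow> \<bar>f x - f y\<bar> \<le> L * \<bar>x - y\<bar>"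
  shows "abs_continuous_on S f"
  unfolding abs_continuous_on_def
proof (intro allI impI)
  fix \<epsilon> :: real assume "\<epsilon> > 0"
  \<comment> \<open>\<open>L\<close> may be zero or negative; \<open>M\<close> is a strictly
    positive Lipschitz constant, so dividing \<epsilon> by it is legitimate.\<close>
  define M where "M = \<bar>L\<bar> + 1"
  have "M > 0" by (simp add: M_def)
  show "\<exists>\<delta>>0. \<forall>(n::nat) a b.
        (\<forall>k<n. a k \<le> b k \<and> {a k..b k} \<subseteq> S) \<and>
        disjoint_family_on (\<lambda>k. {a k<..<b k}) {..<n} \<and>
        (\<Sum>k<n. b k - a k) < \<delta> \<longrightarrow> (\<Sum>k<n. \<bar>f (b k) - f (a k)\<bar>) < \<epsilon>"
  proof (intro exI[of _ "\<epsilon> / M"] conjI allI impI)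
    show "\<epsilon> / M > 0" using \<open>\<epsilon> > 0\<close> \<open>M > 0\<close> by simp
    fix n :: nat and a b :: "nat \<Rightarrow> real"
    assume *: "(\<forall>k<n. a k \<le> b k \<and> {a k..b k} \<subseteq> S) \<and>
        disjoint_family_on (\<lambda>k. {a k<..<b k}) {..<n} \<and> (\<Sum>k<n. b k - a k) < \<epsilon> / M"
    have "(\<Sum>k<n. \<bar>f (b k) - f (a k)\<bar>) \<le> (\<Sum>k<n. M * (b k - a k))"
    proof (rule sum_mono)
      fix k assume "k \<in> {..<n}"
      then have "a k \<le> b k" "{a k..b k} \<subseteq> S" using * by auto
      then have k: "a k \<le> b k" "a k \<in> S" "b k \<in> S" by auto
      have "\<bar>f (b k) - f (a k)\<bar> \<le> L * \<bar>b k - a k\<bar>" using k assms by blast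
      also have "\<dots> \<le> M * \<bar>b k - a k\<bar>" by (intro mult_right_mono) (auto simp: M_def)
      finally show "\<bar>f (b k) - f (a k)\<bar> \<le> M * (b k - a k)" using k by simp
    qed
    also have "\<dots> = M * (\<Sum>k<n. b k - a k)" by (simp add: sum_distrib_left)
    also have "\<dots> < \<epsilon>" using * \<open>M > 0\<close> by (simp add: field_simps)
    finally show "(\<Sum>k<n. \<bar>f (b k) - f (a k)\<bar>) < \<epsilon>" .
  qed
qed

lemma C1_imp_abs_continuous_on:
  assumes "\<And>x. (f has_real_derivative f' x) (at x)" and "continuous_on {a..b} f'"
  shows "abs_continuous_on {a..b} f"
proof -
  have "bounded (f' ` {a..b})"
    using assms(2) compact_Icc compact_continuous_image compact_imp_bounded by blast
  then obtain B where B: "\<And>x. x \<in> {a..b} \<Longrightarrow> norm (f' x) \<le> B"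
    unfolding bounded_iff by blast
  show ?thesis
  proof (rule lipschitz_imp_abs_continuous_on)
    fix x y assume xy: "x \<in> {a..b}" "y \<in> {a..b}"
    have "norm (f x - f y) \<le> B * norm (x - y)"
      by (rule field_differentiable_bound[of "{a..b}" f f'])
         (use xy B in \<open>auto intro: has_field_derivative_at_within[OF assms(1)]\<close>)
    then show "\<bar>f x - f y\<bar> \<le> B * \<bar>x - y\<bar>" by simp
  qed
qed

lemma continuous_antiderivative:
  fixes f :: "real \<Rightarrow> real"
  assumes "continuous_on UNIV f"
  obtains F where "\<And>x. (F has_real_derivative f x) (at x)"
proof -
  have "isCont f x" for x using assms by (simp add: continuous_on_eq_continuous_at)
  then have "\<exists>F. \<forall>x. -\<infinity> < ereal x \<longrightarrow> ereal x < \<infinity> \<longrightarrow> (F has_vector_derivative f x) (at x)"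
    by (intro einterval_antiderivative) auto
  then show ?thesis
    using that by (auto simp: has_real_derivative_iff_has_vector_derivative)
qed

text \<open>Supplies test functions of a prescribed parity. Continuity on the whole line gives
  solutions with two-sided derivatives everywhere. The condition at 0 is the compatibility needed
  for gluing: in the odd case it forces \<open>R 0 = 0\<close>.\<close>

lemma continuous_parity_extension:
  fixes R :: "real \<Rightarrow> real"
  assumes "continuous_on {0..T} R" "R 0 = \<epsilon> * R 0" "\<epsilon> * \<epsilon> = 1" "0 < T"
  obtains \<sigma> where "continuous_on UNIV \<sigma>" "\<And>s. \<sigma> (- s) = \<epsilon> * \<sigma> s"
    "\<And>s. s \<in> {0..T} \<Longrightarrow> \<sigma> s = R s"
proof
  define c where "c s = max 0 (min T s)" for s
  \<comment> \<open>The map \<open>c\<close> clamps to [0, T]. One of \<open>c s\<close> and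
    \<open>c (- s)\<close> is always 0, and the last term cancels the constant that this contributes
    on [0, T].\<close>
  define \<sigma> where "\<sigma> s = R (c s) + \<epsilon> * R (c (- s)) - \<epsilon> * R 0" for s
  have cont: "continuous_on UNIV (\<lambda>s. R (c (h s)))" if "continuous_on UNIV h" for h :: "real \<Rightarrow> real"
    by (rule continuous_on_compose2[OF assms(1)])
       (use \<open>0 < T\<close> that in \<open>auto simp: c_def intro!: continuous_intros\<close>)
  show "continuous_on UNIV \<sigma>"
    unfolding \<sigma>_def by (intro continuous_intros cont)
  have "\<epsilon> = 1 \<or> \<epsilon> = -1"
    using assms(3) by (simp add: square_eq_1_iff)
  then show "\<sigma> (- s) = \<epsilon> * \<sigma> s" for s
    using assms(2) by (auto simp: \<sigma>_def)
  show "\<sigma> s = R s" if "s \<in> {0..T}" for s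
  proof -
    have "c s = s" "c (- s) = 0" using that by (auto simp: c_def)
    then show ?thesis by (simp add: \<sigma>_def)
  qed
qed

lemma integral_fold:
  fixes f :: "real \<Rightarrow> real"
  assumes "continuous_on {-T..T} f" "0 < T"
  shows "integral {-T..T} f = integral {0..T} (\<lambda>s. f s + f (- s))"
proof -
  have i: "f integrable_on {-T..T}" using assms by (intro integrable_continuous_real)
  then have i1: "f integrable_on {-T..0}" "f integrable_on {0..T}"
    using assms(2) by (auto intro: integrable_on_subinterval)
  then have i2: "(\<lambda>s. f (- s)) integrable_on {0..T}"
    using Henstock_Kurzweil_Integration.integrable_reflect_real[where f = f and a = "-T" and b = 0] by simp
  have "integral {-T..T} f = integral {-T..0} f + integral {0..T} f"
    using Henstock_Kurzweil_Integration.integral_combine[OF _ _ i, of 0] assms(2) by simp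
  also have "integral {-T..0} f = integral {0..T} (\<lambda>s. f (- s))"
    using Henstock_Kurzweil_Integration.integral_reflect_real[where f = f and a = "-T" and b = 0] by simp
  finally show ?thesis using i1 i2 by (simp add: Henstock_Kurzweil_Integration.integral_add)
qed

lemma integral_square_eq_0:
  fixes f :: "real \<Rightarrow> real"
  assumes "continuous_on {a..b} f" "a < b" "integral {a..b} (\<lambda>x. f x * f x) = 0" "x \<in> {a..b}"
  shows "f x = 0"
proof -
  have "integral {a..b} (\<lambda>x. f x * f x) = 0 \<longleftrightarrow> (\<forall>x\<in>{a..b}. f x * f x = 0)"
    by (intro integral_eq_0_iff continuous_on_mult assms(1,2)) simp
  with assms(3,4) show ?thesis by auto
qed

section \<open>Kernel representation on the half interval, one parity at a time\<close>

text \<open>Lagrange's identity: \<open>(\<phi> v' - \<phi>' v)' = \<phi> \<sigma>\<close>, and likewise for \<open>\<psi>\<close>.\<close>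
lemma green_representation:
  fixes v v' \<sigma> \<phi> \<phi>' \<psi> \<psi>' :: "real \<Rightarrow> real"
  assumes t: "t \<in> {0..T}"
    and v: "\<And>x. x \<in> {0..T} \<Longrightarrow> (v has_real_derivative v' x) (at x within {0..T})"
    and v': "\<And>x. x \<in> {0..T} \<Longrightarrow> (v' has_real_derivative \<sigma> x - k * v x) (at x within {0..T})"
    and \<phi>: "\<And>x. (\<phi> has_real_derivative \<phi>' x) (at x)"
    and \<phi>': "\<And>x. (\<phi>' has_real_derivative - k * \<phi> x) (at x)"
    and \<psi>: "\<And>x. (\<psi> has_real_derivative \<psi>' x) (at x)"
    and \<psi>': "\<And>x. (\<psi>' has_real_derivative - k * \<psi> x) (at x)"
    and left: "\<phi> 0 * v' 0 = \<phi>' 0 * v 0"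
    and right: "\<psi> T * v' T = \<psi>' T * v T"
    and W: "\<phi> t * \<psi>' t - \<phi>' t * \<psi> t = W"
  shows "((\<lambda>s. \<phi> (min t s) * \<psi> (max t s) * \<sigma> s) has_integral W * v t) {0..T}"
proof -
  have L: "((\<lambda>s. f s * \<sigma> s) has_integral (f b * v' b - f' b * v b) - (f a * v' a - f' a * v a)) {a..b}"
    if ab: "0 \<le> a" "a \<le> b" "b \<le> T"
      and f: "\<And>x. (f has_real_derivative f' x) (at x)"
      and f': "\<And>x. (f' has_real_derivative - k * f x) (at x)" for a b and f f' :: "real \<Rightarrow> real"
  proof (rule fundamental_theorem_of_calculus[OF ab(2)])
    fix x assume x: "x \<in> {a..b}"
    then have sub: "{a..b} \<subseteq> {0..T}" "x \<in> {0..T}" using ab by auto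
    have "((\<lambda>x. f x * v' x - f' x * v x) has_real_derivative f x * \<sigma> x) (at x within {a..b})"
      by (rule derivative_eq_intros DERIV_subset[OF v[OF sub(2)] sub(1)]
            DERIV_subset[OF v'[OF sub(2)] sub(1)] has_field_derivative_at_within[OF f]
            has_field_derivative_at_within[OF f'] refl)+ (simp add: algebra_simps)
    then show "((\<lambda>x. f x * v' x - f' x * v x) has_vector_derivative f x * \<sigma> x) (at x within {a..b})"
      by (simp add: has_real_derivative_iff_has_vector_derivative)
  qed
  \<comment> \<open>The kernel is split at its diagonal. Integrating Lagrange's identity on [0, t]
    and on [t, T] leaves only boundary terms at \<open>t\<close>, since \<open>left\<close> and
    \<open>right\<close> remove those at 0 and \<open>T\<close>. In the sum the terms with
    \<open>v' t\<close> cancel and the Wronskian remains.\<close>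
  have "((\<lambda>s. \<psi> t * (\<phi> s * \<sigma> s)) has_integral \<psi> t * (\<phi> t * v' t - \<phi>' t * v t)) {0..t}"
    by (rule has_integral_mult_right) (use L[OF _ _ _ \<phi> \<phi>', of 0 t] t left in auto)
  then have 1: "((\<lambda>s. \<phi> (min t s) * \<psi> (max t s) * \<sigma> s) has_integral \<psi> t * (\<phi> t * v' t - \<phi>' t * v t)) {0..t}"
    by (rule has_integral_eq[rotated]) (auto simp: min_def max_def dest: antisym)
  have "((\<lambda>s. \<phi> t * (\<psi> s * \<sigma> s)) has_integral \<phi> t * - (\<psi> t * v' t - \<psi>' t * v t)) {t..T}"
    by (rule has_integral_mult_right) (use L[OF _ _ _ \<psi> \<psi>', of t T] t right in auto)
  then have 2: "((\<lambda>s. \<phi> (min t s) * \<psi> (max t s) * \<sigma> s) has_integral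
      \<phi> t * - (\<psi> t * v' t - \<psi>' t * v t)) {t..T}"
    by (rule has_integral_eq[rotated]) (auto simp: min_def max_def)
  have "\<psi> t * (\<phi> t * v' t - \<phi>' t * v t) + \<phi> t * - (\<psi> t * v' t - \<psi>' t * v t) = W * v t"
    unfolding W[symmetric] by (simp add: algebra_simps)
  with has_integral_combine[OF _ _ 1 2] t show ?thesis by simp
qed

text \<open>\<open>\<epsilon> = 1\<close> is the even problem, \<open>\<epsilon> = -1\<close> the odd one; \<open>\<phi>\<close> has the parity of the problem, and
  \<open>\<psi>\<close> encodes the boundary condition at \<open>T\<close> as \<open>\<psi> T * v' T = \<psi>' T * v T\<close>.\<close>
locale parity_pair =
  fixes T m \<epsilon> W :: real and \<phi> \<phi>' \<psi> \<psi>' :: "real \<Rightarrow> real"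
  assumes T_pos: "0 < T"
    and eps: "\<epsilon> * \<epsilon> = 1"
    and \<phi>: "\<And>x. (\<phi> has_real_derivative \<phi>' x) (at x)"
    and \<phi>': "\<And>x. (\<phi>' has_real_derivative - (\<epsilon> * m) * \<phi> x) (at x)"
    and \<psi>: "\<And>x. (\<psi> has_real_derivative \<psi>' x) (at x)"
    and \<psi>': "\<And>x. (\<psi>' has_real_derivative - (\<epsilon> * m) * \<psi> x) (at x)"
    and \<phi>_parity: "\<And>x. \<phi> (- x) = \<epsilon> * \<phi> x"
    and \<phi>'_parity: "\<And>x. \<phi>' (- x) = - \<epsilon> * \<phi>' x"
    and wronskian: "\<And>x. \<phi> x * \<psi>' x - \<phi>' x * \<psi> x = W"
    and W_nonzero: "W \<noteq> 0"
begin

lemma eps2: "\<epsilon> * (\<epsilon> * x) = x"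
  using eps by (metis mult.assoc mult_1)

text \<open>In the even case both derivatives vanish at 0, in the odd case both functions do, so
  each side is 0.\<close>

lemma left_boundary:
  fixes v v' :: "real \<Rightarrow> real"
  assumes "v 0 = \<epsilon> * v 0" "v' 0 = - \<epsilon> * v' 0"
  shows "\<phi> 0 * v' 0 = \<phi>' 0 * v 0"
proof -
  have "\<phi> 0 = \<epsilon> * \<phi> 0" "\<phi>' 0 = - \<epsilon> * \<phi>' 0"
    by (fact \<phi>_parity[of 0, unfolded minus_zero] \<phi>'_parity[of 0, unfolded minus_zero])+
  moreover have "\<epsilon> = 1 \<or> \<epsilon> = -1"
    using eps by (simp add: square_eq_1_iff)
  ultimately show ?thesis using assms by auto
qed

text \<open>Existence in three moves: variation of parameters gives some solution, averaging with
  its reflection gives it the right parity, and a multiple of \<phi> corrects the boundary condition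
  at \<open>T\<close>.\<close>

lemma parity_solution:
  assumes \<sigma>: "continuous_on UNIV \<sigma>" and par: "\<And>s. \<sigma> (- s) = \<epsilon> * \<sigma> s"
  obtains v v' where "\<And>x. (v has_real_derivative v' x) (at x)"
    "\<And>x. (v' has_real_derivative \<sigma> x - (\<epsilon> * m) * v x) (at x)"
    "\<And>x. v (- x) = \<epsilon> * v x" "\<And>x. v' (- x) = - \<epsilon> * v' x"
    "\<psi> T * v' T = \<psi>' T * v T"
proof -
  have c: "continuous_on UNIV \<phi>" "continuous_on UNIV \<psi>"
    by (rule DERIV_continuous_on, rule \<phi> \<psi>)+
  obtain P where P: "\<And>x. (P has_real_derivative \<phi> x * \<sigma> x) (at x)"
    using continuous_antiderivative[OF continuous_on_mult[OF c(1) \<sigma>]] by blast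
  obtain Q where Q: "\<And>x. (Q has_real_derivative \<psi> x * \<sigma> x) (at x)"
    using continuous_antiderivative[OF continuous_on_mult[OF c(2) \<sigma>]] by blast
  \<comment> \<open>In the derivative of \<open>u\<close> the terms containing \<sigma> cancel, so
    \<open>u'\<close> has the same form; in the derivative of \<open>u'\<close> they add up to the
    Wronskian times \<sigma>.\<close>
  define u where "u x = (\<psi> x * P x - \<phi> x * Q x) / W" for x
  define u' where "u' x = (\<psi>' x * P x - \<phi>' x * Q x) / W" for x
  have u: "(u has_real_derivative u' x) (at x)" for x
    unfolding u_def u'_def
    by (rule DERIV_cdivide, (rule derivative_eq_intros P Q \<phi> \<psi> refl)+) (simp add: algebra_simps)
  have u': "(u' has_real_derivative \<sigma> x - (\<epsilon> * m) * u x) (at x)" for x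
  proof -
    have "(u' has_real_derivative ((- (\<epsilon> * m) * \<psi> x) * P x + \<psi>' x * (\<phi> x * \<sigma> x)
        - ((- (\<epsilon> * m) * \<phi> x) * Q x + \<phi>' x * (\<psi> x * \<sigma> x))) / W) (at x)"
      unfolding u'_def
      by (rule DERIV_cdivide, (rule derivative_eq_intros P Q \<phi>' \<psi>' refl)+) (simp add: algebra_simps)
    also have "((- (\<epsilon> * m) * \<psi> x) * P x + \<psi>' x * (\<phi> x * \<sigma> x)
        - ((- (\<epsilon> * m) * \<phi> x) * Q x + \<phi>' x * (\<psi> x * \<sigma> x)))
        = (\<phi> x * \<psi>' x - \<phi>' x * \<psi> x) * \<sigma> x - (\<epsilon> * m) * (\<psi> x * P x - \<phi> x * Q x)"
      by (simp add: algebra_simps)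
    also have "\<dots> / W = \<sigma> x - (\<epsilon> * m) * u x"
      unfolding wronskian u_def using W_nonzero by (simp add: field_simps)
    finally show ?thesis .
  qed
  \<comment> \<open>As \<sigma> has parity \<epsilon>, the reflection
    \<open>\<epsilon> * u (- x)\<close> solves the same equation as \<open>u\<close>, hence so does
    the average.\<close>
  define e where "e x = (u x + \<epsilon> * u (- x)) / 2" for x
  define e' where "e' x = (u' x - \<epsilon> * u' (- x)) / 2" for x
  have neg: "((\<lambda>x. f (- x)) has_real_derivative - d) (at x)"
    if "(f has_real_derivative d) (at (- x))" for f :: "real \<Rightarrow> real" and d x
    using that by (simp add: DERIV_mirror)
  have e: "(e has_real_derivative e' x) (at x)" for x
    unfolding e_def e'_def
    by (rule DERIV_cdivide, (rule derivative_eq_intros u neg[OF u] refl)+) simp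
  have e': "(e' has_real_derivative \<sigma> x - (\<epsilon> * m) * e x) (at x)" for x
  proof -
    have "(e' has_real_derivative ((\<sigma> x - (\<epsilon> * m) * u x)
        - \<epsilon> * - (\<sigma> (- x) - (\<epsilon> * m) * u (- x))) / 2) (at x)"
      unfolding e'_def by (intro DERIV_cdivide DERIV_diff DERIV_cmult u' neg)
    also have "(\<sigma> x - (\<epsilon> * m) * u x) - \<epsilon> * - (\<sigma> (- x) - (\<epsilon> * m) * u (- x))
        = 2 * (\<sigma> x - (\<epsilon> * m) * e x)"
      by (simp add: e_def par algebra_simps eps2)
    also have "\<dots> / 2 = \<sigma> x - (\<epsilon> * m) * e x" by simp
    finally show ?thesis .
  qed
  \<comment> \<open>Adding \<open>A * \<phi>\<close> changes neither equation nor parity. It changes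
    the boundary defect \<open>\<psi> T * e' T - \<psi>' T * e T\<close> by \<open>- A * W\<close>,
    which determines \<open>A\<close>.\<close>
  define A where "A = (\<psi> T * e' T - \<psi>' T * e T) / W"
  show ?thesis
  proof (rule that[of "\<lambda>x. e x + A * \<phi> x" "\<lambda>x. e' x + A * \<phi>' x"])
    fix x
    show "((\<lambda>x. e x + A * \<phi> x) has_real_derivative e' x + A * \<phi>' x) (at x)"
      by (rule derivative_eq_intros e \<phi> refl)+ simp
    show "((\<lambda>x. e' x + A * \<phi>' x) has_real_derivative \<sigma> x - \<epsilon> * m * (e x + A * \<phi> x)) (at x)"
      by (rule derivative_eq_intros e' \<phi>' refl)+ (simp add: algebra_simps)
    show "e (- x) + A * \<phi> (- x) = \<epsilon> * (e x + A * \<phi> x)"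
      by (simp add: e_def \<phi>_parity algebra_simps add_divide_distrib eps2)
    show "e' (- x) + A * \<phi>' (- x) = - \<epsilon> * (e' x + A * \<phi>' x)"
      by (simp add: e'_def \<phi>'_parity algebra_simps diff_divide_distrib eps2)
  next
    have "A * (\<phi> T * \<psi>' T - \<phi>' T * \<psi> T) = \<psi> T * e' T - \<psi>' T * e T"
      unfolding wronskian A_def using W_nonzero by simp
    then show "\<psi> T * (e' T + A * \<phi>' T) = \<psi>' T * (e T + A * \<phi> T)"
      by (simp add: algebra_simps)
  qed
qed

text \<open>Derivatives are taken within [-T, T] so that the result serves both the global solutions
  constructed above and Dirichlet solutions, which are known only on that interval.\<close>

lemma parity_solution_representation:
  fixes v v' :: "real \<Rightarrow> real"
  assumes "t \<in> {0..T}"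
    and "\<And>x. x \<in> {-T..T} \<Longrightarrow> (v has_real_derivative v' x) (at x within {-T..T})"
    and "\<And>x. x \<in> {-T..T} \<Longrightarrow> (v' has_real_derivative \<sigma> x - (\<epsilon> * m) * v x) (at x within {-T..T})"
    and "v 0 = \<epsilon> * v 0" "v' 0 = - \<epsilon> * v' 0"
    and "\<psi> T * v' T = \<psi>' T * v T"
  shows "((\<lambda>s. \<phi> (min t s) * \<psi> (max t s) * \<sigma> s) has_integral W * v t) {0..T}"
proof (rule green_representation[where k = "\<epsilon> * m", OF assms(1) _ _ \<phi> \<phi>' \<psi> \<psi>' left_boundary])
  fix x assume x: "x \<in> {0..T}"
  have sub: "{0..T} \<subseteq> {-T..T}" using T_pos by auto
  show "(v has_real_derivative v' x) (at x within {0..T})"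
    using x sub by (intro DERIV_subset[OF assms(2)]) auto
  show "(v' has_real_derivative \<sigma> x - \<epsilon> * m * v x) (at x within {0..T})"
    using x sub by (intro DERIV_subset[OF assms(3)]) auto
qed (use assms wronskian in auto)

text \<open>Parity turns \<open>m * v (- t)\<close> into \<open>\<epsilon> * m * v t\<close>, so the
  reflected equation becomes an ordinary one. For an even function periodicity means a vanishing
  derivative at \<open>T\<close>, for an odd one a vanishing value; \<open>periodic\<close> states
  that \<psi> encodes this condition.\<close>

lemma periodic_solution_of_parity:
  fixes v v' :: "real \<Rightarrow> real"
  assumes periodic: "\<And>a b. \<psi> T * b = \<psi>' T * a \<Longrightarrow> a = \<epsilon> * a \<and> b = - \<epsilon> * b"
    and \<sigma>: "continuous_on UNIV \<sigma>"
    and v: "\<And>x. (v has_real_derivative v' x) (at x)"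
      "\<And>x. (v' has_real_derivative \<sigma> x - (\<epsilon> * m) * v x) (at x)"
      "\<And>x. v (- x) = \<epsilon> * v x" "\<And>x. v' (- x) = - \<epsilon> * v' x"
      "\<psi> T * v' T = \<psi>' T * v T"
  shows "periodic_solution T m \<sigma> v"
  unfolding periodic_solution_def
proof (intro exI[of _ v'] conjI)
  show "\<forall>t\<in>{-T..T}. (v has_real_derivative v' t) (at t within {-T..T})"
    by (intro ballI has_field_derivative_at_within[OF v(1)])
  have "continuous_on UNIV v" "continuous_on UNIV v'"
    by (rule DERIV_continuous_on, rule v)+
  then have "continuous_on UNIV (\<lambda>x. \<sigma> x - (\<epsilon> * m) * v x)"
    using \<sigma> by (intro continuous_intros)
  then show "abs_continuous_on {-T..T} v'"
    by (intro C1_imp_abs_continuous_on[OF v(2)]) (rule continuous_on_subset, auto)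
  show "continuous_on {-T..T} v'"
    using \<open>continuous_on UNIV v'\<close> by (rule continuous_on_subset) simp
  have "\<exists>w. (v' has_real_derivative w) (at t within {-T..T}) \<and> w + m * v (- t) = \<sigma> t" for t
    using has_field_derivative_at_within[OF v(2)[of t]] by (auto simp: v(3) mult_ac intro!: exI)
  then show "AE t in lebesgue_on {-T..T}.
      \<exists>w. (v' has_real_derivative w) (at t within {-T..T}) \<and> w + m * v (- t) = \<sigma> t"
    by simp
  show "v T = v (- T)" "v' T = v' (- T)"
    using periodic[OF v(5)] v(3,4) by simp_all
qed

text \<open>Folding the integral of \<open>G p\<close> against a \<sigma> of parity \<epsilon>
  leaves \<open>G p s + \<epsilon> * G p (- s)\<close> on [0, T], while the explicit kernel yields
  the same solution value. The difference \<open>R\<close> of the two kernels is thus orthogonal to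
  every such \<sigma>, in particular to its own extension, so the integral of its square is
  0.\<close>

lemma greens_function_parity_part:
  assumes periodic: "\<And>a b. \<psi> T * b = \<psi>' T * a \<Longrightarrow> a = \<epsilon> * a \<and> b = - \<epsilon> * b"
    and G: "is_greens_function T m G" and p: "p \<in> {-T..T}" and s: "s \<in> {0..T}"
  shows "G p s + \<epsilon> * G p (- s)
    = (if 0 \<le> p then 1 else \<epsilon>) * \<phi> (min \<bar>p\<bar> s) * \<psi> (max \<bar>p\<bar> s) / W"
proof -
  define c where "c = (if 0 \<le> p then 1 else \<epsilon>)"
  define K where "K s = c * (\<phi> (min \<bar>p\<bar> s) * \<psi> (max \<bar>p\<bar> s)) / W" for s
  define R where "R s = G p s + \<epsilon> * G p (- s) - K s" for s
  have Gc: "continuous_on ({-T..T} \<times> {-T..T}) (\<lambda>(t, s). G t s)"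
    using G by (simp add: is_greens_function_def)
  have "continuous_on {-T..T} (\<lambda>s. (\<lambda>(t, s). G t s) (p, s))"
    by (rule continuous_on_compose2[OF Gc]) (use p in \<open>auto intro!: continuous_intros\<close>)
  then have Gp: "continuous_on {-T..T} (G p)" by simp
  have Gpc: "continuous_on {0..T} (\<lambda>s. G p s)" "continuous_on {0..T} (\<lambda>s. G p (- s))"
    using T_pos by (auto intro!: continuous_on_compose2[OF Gp] continuous_intros)
  have c\<phi>: "continuous_on UNIV \<phi>" "continuous_on UNIV \<psi>"
    by (rule DERIV_continuous_on, rule \<phi> \<psi>)+
  have Kc: "continuous_on {0..T} K"
    unfolding K_def
    by (intro continuous_intros continuous_on_compose2[OF c\<phi>(1)] continuous_on_compose2[OF c\<phi>(2)])
       (use W_nonzero in auto)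
  have Rc: "continuous_on {0..T} R"
    unfolding R_def using Gpc Kc by (intro continuous_intros)
  \<comment> \<open>In the odd case \<phi> vanishes at 0, hence so do \<open>K\<close> and
    \<open>R\<close>, and \<open>R\<close> has a continuous odd extension.\<close>
  have "\<phi> 0 = \<epsilon> * \<phi> 0" by (fact \<phi>_parity[of 0, unfolded minus_zero])
  then have "K 0 = \<epsilon> * K 0" using T_pos p by (auto simp: K_def)
  then have R0: "R 0 = \<epsilon> * R 0"
    unfolding R_def by (simp add: algebra_simps eps2)
  obtain \<sigma> where \<sigma>: "continuous_on UNIV \<sigma>" "\<And>s. \<sigma> (- s) = \<epsilon> * \<sigma> s"
    and \<sigma>R: "\<And>s. s \<in> {0..T} \<Longrightarrow> \<sigma> s = R s"
    using continuous_parity_extension[OF Rc R0 eps T_pos] by blast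
  obtain v v' where v: "\<And>x. (v has_real_derivative v' x) (at x)"
    "\<And>x. (v' has_real_derivative \<sigma> x - (\<epsilon> * m) * v x) (at x)"
    "\<And>x. v (- x) = \<epsilon> * v x" "\<And>x. v' (- x) = - \<epsilon> * v' x"
    "\<psi> T * v' T = \<psi>' T * v T"
    using parity_solution[OF \<sigma>] by blast
  have \<sigma>c: "continuous_on A \<sigma>" for A using \<sigma>(1) by (rule continuous_on_subset) simp
  have G\<sigma>: "continuous_on {-T..T} (\<lambda>s. G p s * \<sigma> s)"
    using Gp \<sigma>c by (intro continuous_intros)
  \<comment> \<open>The uniqueness clause of the Green's function identifies the constructed
    periodic solution with the integral.\<close>
  have "v p = (LINT s:{-T..T}|lebesgue. G p s * \<sigma> s)"
    using G periodic_solution_of_parity[OF periodic \<sigma>(1) v] p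
      absolutely_integrable_continuous_real[OF \<sigma>c] by (auto simp: is_greens_function_def)
  also have "\<dots> = integral {-T..T} (\<lambda>s. G p s * \<sigma> s)"
    by (intro set_lebesgue_integral_eq_integral absolutely_integrable_continuous_real G\<sigma>)
  also have "\<dots> = integral {0..T} (\<lambda>s. (G p s + \<epsilon> * G p (- s)) * \<sigma> s)"
    unfolding integral_fold[OF G\<sigma> T_pos] by (simp add: \<sigma>(2) algebra_simps)
  finally have vp: "v p = integral {0..T} (\<lambda>s. (G p s + \<epsilon> * G p (- s)) * \<sigma> s)" .
  have vc: "v p = c * v \<bar>p\<bar>"
    using v(3)[of "\<bar>p\<bar>"] by (auto simp: c_def)
  note v0 = v(3,4)[of 0, unfolded minus_zero]
  have "\<bar>p\<bar> \<in> {0..T}" using p by auto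
  then have "((\<lambda>s. \<phi> (min \<bar>p\<bar> s) * \<psi> (max \<bar>p\<bar> s) * \<sigma> s) has_integral W * v \<bar>p\<bar>) {0..T}"
    by (rule parity_solution_representation[OF _ has_field_derivative_at_within[OF v(1)]
          has_field_derivative_at_within[OF v(2)] v0 v(5)])
  from has_integral_mult_right[OF this, of "c / W"]
  have vK: "((\<lambda>s. K s * \<sigma> s) has_integral v p) {0..T}"
    using W_nonzero by (simp add: K_def vc mult_ac)
  have i: "(\<lambda>s. (G p s + \<epsilon> * G p (- s)) * \<sigma> s) integrable_on {0..T}"
    using Gpc \<sigma>c by (intro integrable_continuous_real continuous_intros)
  have "integral {0..T} (\<lambda>s. R s * R s)
      = integral {0..T} (\<lambda>s. (G p s + \<epsilon> * G p (- s)) * \<sigma> s - K s * \<sigma> s)"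
    by (intro Henstock_Kurzweil_Integration.integral_cong) (simp add: \<sigma>R R_def algebra_simps)
  also have "\<dots> = v p - v p"
    unfolding Henstock_Kurzweil_Integration.integral_diff[OF i has_integral_integrable[OF vK]]
    by (simp only: integral_unique[OF vK] vp[symmetric])
  finally have "R s = 0"
    using integral_square_eq_0[OF Rc T_pos _ s] by simp
  then show ?thesis by (simp add: R_def K_def c_def mult.assoc)
qed

end

section \<open>The three concrete pairs and the parity parts of the Green's function\<close>

text \<open>Since \<psi> has value 1 and slope 0 at \<open>T\<close>, the encoded condition is
  \<open>v' T = 0\<close>, which is periodicity for even functions.\<close>

lemma neumann_pair:
  assumes "0 < T" "0 < w" "sin (w * T) \<noteq> 0"
  shows "parity_pair T (w\<^sup>2) 1 (w * sin (w * T)) (\<lambda>x. cos (w * x)) (\<lambda>x. - w * sin (w * x))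
    (\<lambda>x. cos (w * (T - x))) (\<lambda>x. w * sin (w * (T - x)))"
proof
  fix x
  have "sin (w * T) = sin (w * x + w * (T - x))" by (simp add: algebra_simps)
  then show "cos (w * x) * (w * sin (w * (T - x))) - - w * sin (w * x) * cos (w * (T - x)) = w * sin (w * T)"
    unfolding sin_add by (simp add: algebra_simps)
qed (use assms in \<open>auto intro!: derivative_eq_intros simp: power2_eq_square\<close>)

text \<open>The same even equation, but with \<open>\<psi> T = 0\<close>, which encodes
  \<open>v T = 0\<close>; this pair is for the eigenvalue problem.\<close>

lemma dirichlet_even_pair:
  assumes "0 < T" "0 < w" "cos (w * T) \<noteq> 0"
  shows "parity_pair T (w\<^sup>2) 1 (- w * cos (w * T)) (\<lambda>x. cos (w * x)) (\<lambda>x. - w * sin (w * x))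
    (\<lambda>x. sin (w * (T - x))) (\<lambda>x. - w * cos (w * (T - x)))"
proof
  fix x
  have *: "cos (w * T) = cos (w * x) * cos (w * (T - x)) - sin (w * x) * sin (w * (T - x))"
    unfolding cos_add[symmetric] by (simp add: algebra_simps)
  show "cos (w * x) * (- w * cos (w * (T - x))) - - w * sin (w * x) * sin (w * (T - x)) = - w * cos (w * T)"
    unfolding * by (simp add: algebra_simps)
qed (use assms in \<open>auto intro!: derivative_eq_intros simp: power2_eq_square\<close>)

text \<open>Odd parity reverses the sign of \<open>m\<close>, hence the hyperbolic functions. For
  odd functions \<open>v T = 0\<close> is at once the periodic and the Dirichlet condition, so this
  pair serves both problems.\<close>

lemma dirichlet_odd_pair:
  fixes T w :: real
  assumes "0 < T" "0 < w"
  shows "parity_pair T (w\<^sup>2) (-1) (- w * sinh (w * T)) (\<lambda>x. sinh (w * x)) (\<lambda>x. w * cosh (w * x))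
    (\<lambda>x. sinh (w * (T - x))) (\<lambda>x. - w * cosh (w * (T - x)))"
proof
  fix x
  have "sinh (w * T) = sinh (w * x + w * (T - x))" by (simp add: algebra_simps)
  then show "sinh (w * x) * (- w * cosh (w * (T - x))) - w * cosh (w * x) * sinh (w * (T - x)) = - w * sinh (w * T)"
    unfolding sinh_add by (simp add: algebra_simps)
qed (use assms in \<open>auto intro!: derivative_eq_intros simp: power2_eq_square\<close>)

lemma greens_function_even_part:
  assumes "0 < T" "0 < w" "sin (w * T) \<noteq> 0" "is_greens_function T (w\<^sup>2) G"
    and "p \<in> {-T..T}" "s \<in> {0..T}"
  shows "G p s + G p (- s) = cos (w * min \<bar>p\<bar> s) * cos (w * (T - max \<bar>p\<bar> s)) / (w * sin (w * T))"
  using parity_pair.greens_function_parity_part[OF neumann_pair[OF assms(1-3)] _ assms(4-6)] assms(2)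
  by simp

text \<open>The difference changes sign with \<open>p\<close>; positivity only depends on its size,
  hence the absolute value.\<close>

lemma greens_function_odd_part:
  assumes "0 < T" "0 < w" "is_greens_function T (w\<^sup>2) G"
    and "p \<in> {-T..T}" "s \<in> {0..T}"
  shows "\<bar>G p s - G p (- s)\<bar> = sinh (w * min \<bar>p\<bar> s) * sinh (w * (T - max \<bar>p\<bar> s)) / (w * sinh (w * T))"
proof -
  define X where "X = sinh (w * min \<bar>p\<bar> s) * sinh (w * (T - max \<bar>p\<bar> s)) / (w * sinh (w * T))"
  have "0 \<le> X"
    unfolding X_def using assms by (intro divide_nonneg_nonneg mult_nonneg_nonneg) auto
  moreover have "G p s - G p (- s) = - X \<or> G p s - G p (- s) = X"
    using parity_pair.greens_function_parity_part[OF dirichlet_odd_pair[OF assms(1-2)] _ assms(3-5)] assms(2)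
    by (auto simp: X_def)
  ultimately show ?thesis unfolding X_def[symmetric] by linarith
qed

section \<open>Trigonometric against hyperbolic kernel, and the sign of the Green's function\<close>

text \<open>A division-free form of cot x \<le> coth x. The difference of the two sides vanishes at
  0 and has derivative \<open>2 * sin y * sinh y\<close>, nonnegative up to \<pi>.\<close>

lemma sin_cosh_ge_cos_sinh:
  fixes x :: real
  assumes "0 \<le> x" "x \<le> pi"
  shows "cos x * sinh x \<le> sin x * cosh x"
proof -
  have "sin 0 * cosh 0 - cos 0 * sinh 0 \<le> sin x * cosh x - cos x * sinh x"
  proof (rule DERIV_nonneg_imp_nondecreasing[OF assms(1)])
    fix y :: real assume y: "0 \<le> y" "y \<le> x"
    have "((\<lambda>x. sin x * cosh x - cos x * sinh x) has_real_derivative 2 * sin y * sinh y) (at y)"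
      by (auto intro!: derivative_eq_intros)
    moreover have "0 \<le> 2 * sin y * sinh y"
      using y assms by (auto intro!: mult_nonneg_nonneg sin_ge_zero)
    ultimately show "\<exists>d. ((\<lambda>x. sin x * cosh x - cos x * sinh x) has_real_derivative d) (at y) \<and> 0 \<le> d"
      by blast
  qed
  then show ?thesis by simp
qed

text \<open>That is, \<open>1 / (coth x + coth y) \<le> 1 / (cot x + cot y)\<close>.\<close>
lemma sinh_sinh_sin_le:
  fixes x y :: real
  assumes "0 \<le> x" "x \<le> pi" "0 \<le> y" "y \<le> pi"
  shows "sinh x * sinh y * sin (x + y) \<le> sin x * sin y * sinh (x + y)"
proof -
  have "0 \<le> (sin x * sinh x) * (sin y * cosh y - cos y * sinh y)
      + (sin y * sinh y) * (sin x * cosh x - cos x * sinh x)"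
    using sin_cosh_ge_cos_sinh[OF assms(1,2)] sin_cosh_ge_cos_sinh[OF assms(3,4)] assms
    by (intro add_nonneg_nonneg mult_nonneg_nonneg sin_ge_zero) auto
  then show ?thesis by (simp add: sin_add sinh_add algebra_simps)
qed

text \<open>Replacing \<open>y\<close> by the larger \<open>z = a - x\<close> raises the left side
  and lowers the right one, so the worst case is \<open>x + y = a\<close>. There
  \<open>cos x * cos z\<close> exceeds \<open>sin x * sin z\<close> by \<open>cos a > 0\<close>,
  which gives strictness.\<close>

lemma odd_part_less_even_part:
  fixes x y a :: real
  assumes "0 \<le> x" "0 \<le> y" "x + y \<le> a" "0 < a" "a < pi / 2"
  shows "sinh x * sinh y / sinh a < cos x * cos y / sin a"
proof -
  define z where "z = a - x"
  have z: "y \<le> z" "0 \<le> z" "z \<le> a" "x \<le> a" "a = x + z" using assms by (auto simp: z_def)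
  have sina: "0 < sin a" and cosa: "0 < cos a"
    using assms by (auto intro!: sin_gt_zero cos_gt_zero)
  have "sinh x * sinh y * sin a \<le> sinh x * sinh z * sin a"
    using assms z sina by (intro mult_mono) auto
  also have "\<dots> \<le> sin x * sin z * sinh a"
    unfolding z(5) by (rule sinh_sinh_sin_le) (use assms z in auto)
  also have "\<dots> < cos x * cos z * sinh a"
    using cosa assms(4) unfolding z(5) cos_add by (intro mult_strict_right_mono) auto
  also have "\<dots> \<le> cos x * cos y * sinh a"
    using assms z by (intro mult_mono cos_monotone_0_pi_le cos_ge_zero mult_nonneg_nonneg) auto
  finally show ?thesis using sina assms(4) by (simp add: field_simps)
qed

lemma greens_function_pos:
  assumes "0 < T" "0 < w" "w * T < pi / 2" "is_greens_function T (w\<^sup>2) G"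
    and "t \<in> {-T..T}" "s \<in> {-T..T}"
  shows "0 < G t s"
proof -
  define N where "N = cos (w * min \<bar>t\<bar> \<bar>s\<bar>) * cos (w * (T - max \<bar>t\<bar> \<bar>s\<bar>)) / (w * sin (w * T))"
  define D where "D = sinh (w * min \<bar>t\<bar> \<bar>s\<bar>) * sinh (w * (T - max \<bar>t\<bar> \<bar>s\<bar>)) / (w * sinh (w * T))"
  have a: "0 < w * T" using assms by simp
  then have sin: "sin (w * T) \<noteq> 0" using sin_gt_zero[of "w * T"] assms(3) pi_gt_zero by linarith
  have s: "\<bar>s\<bar> \<in> {0..T}" using assms by auto
  have e: "G t \<bar>s\<bar> + G t (- \<bar>s\<bar>) = N"
    unfolding N_def by (rule greens_function_even_part[OF assms(1,2) sin assms(4,5) s])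
  have o: "\<bar>G t \<bar>s\<bar> - G t (- \<bar>s\<bar>)\<bar> = D"
    unfolding D_def by (rule greens_function_odd_part[OF assms(1,2,4,5) s])
  have "w * min \<bar>t\<bar> \<bar>s\<bar> + w * (T - max \<bar>t\<bar> \<bar>s\<bar>) \<le> w * T"
    unfolding distrib_left[symmetric] using assms(2) by (intro mult_left_mono) auto
  moreover have "0 \<le> w * min \<bar>t\<bar> \<bar>s\<bar>" "0 \<le> w * (T - max \<bar>t\<bar> \<bar>s\<bar>)"
    using assms by (auto intro!: mult_nonneg_nonneg)
  ultimately have "sinh (w * min \<bar>t\<bar> \<bar>s\<bar>) * sinh (w * (T - max \<bar>t\<bar> \<bar>s\<bar>)) / sinh (w * T)
      < cos (w * min \<bar>t\<bar> \<bar>s\<bar>) * cos (w * (T - max \<bar>t\<bar> \<bar>s\<bar>)) / sin (w * T)"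
    by (intro odd_part_less_even_part a assms(3))
  from divide_strict_right_mono[OF this assms(2)] have "D < N"
    unfolding N_def D_def by (simp only: divide_divide_eq_left mult.commute[of w "sin _"] mult.commute[of w "sinh _"])
  \<comment> \<open>The two values are \<open>(N + D) / 2\<close> and \<open>(N - D) / 2\<close> in
    some order, and \<open>s\<close> is one of the two arguments.\<close>
  with e o have "0 < G t \<bar>s\<bar>" "0 < G t (- \<bar>s\<bar>)" by linarith+
  then show ?thesis by (cases "0 \<le> s") auto
qed

lemma greens_function_not_pos:
  assumes "0 < T" "0 < w" "pi / 2 \<le> w * T" "sin (w * T) \<noteq> 0" "is_greens_function T (w\<^sup>2) G"
  shows "\<exists>s\<in>{-T..T}. G 0 s \<le> 0"
proof -
  \<comment> \<open>The lower bound on \<open>w * T\<close> makes \<open>s\<close> nonnegative. At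
    \<open>t = 0\<close> the even part vanishes at this \<open>s\<close>, so \<open>G 0 s\<close>
    and \<open>G 0 (- s)\<close> are opposite and cannot both be positive.\<close>
  define s where "s = T - pi / (2 * w)"
  have s: "s \<in> {0..T}" using assms by (auto simp: s_def field_simps)
  have "w * (T - s) = pi / 2" using assms(2) by (simp add: s_def)
  then have "cos (w * (T - s)) = 0" by (simp only: cos_pi_half)
  then have "G 0 s + G 0 (- s) = 0"
    using greens_function_even_part[OF assms(1,2,4,5), of 0 s] s assms(1) by (simp add: max_def)
  then have "G 0 s \<le> 0 \<or> G 0 (- s) \<le> 0" by linarith
  then show ?thesis using s by (auto intro: bexI[of _ s] bexI[of _ "- s"])
qed

section \<open>The smallest positive Dirichlet eigenvalue\<close>

lemma has_real_derivative_reflect_within: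
  assumes "(f has_real_derivative d) (at (- x) within {-T..T})"
  shows "((\<lambda>x. f (- x)) has_real_derivative - d) (at x within {-T..T})"
proof -
  have "uminus ` {-T..T} = {-T..T}" by simp
  then have "(f \<circ> uminus has_real_derivative d * - 1) (at x within {-T..T})"
    using assms by (intro DERIV_image_chain) (auto intro!: derivative_eq_intros)
  then show ?thesis by (simp add: o_def)
qed

text \<open>For \<open>w * T\<close> below \<pi>/2 both Dirichlet pairs have nonzero Wronskian. The
  kernel representation with zero right-hand side then kills the even and the odd part of
  \<open>z\<close>.\<close>

lemma dirichlet_eigenvalue_ge:
  assumes "0 < T" "0 < w" "dirichlet_eigenvalue T (w\<^sup>2)"
  shows "pi / 2 \<le> w * T"
proof (rule ccontr)
  assume "\<not> ?thesis"
  then have cos: "cos (w * T) \<noteq> 0" using assms cos_gt_zero[of "w * T"] by auto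
  obtain z z' where z: "\<And>x. x \<in> {-T..T} \<Longrightarrow> (z has_real_derivative z' x) (at x within {-T..T})"
    and z': "\<And>x. x \<in> {-T..T} \<Longrightarrow> (z' has_real_derivative - w\<^sup>2 * z (- x)) (at x within {-T..T})"
    and bc: "z (- T) = 0" "z T = 0" and nz: "\<exists>t\<in>{-T..T}. z t \<noteq> 0"
    using assms(3) unfolding dirichlet_eigenvalue_def dirichlet_solution_def by blast
  have zn: "((\<lambda>x. z (- x)) has_real_derivative - z' (- x)) (at x within {-T..T})"
    and z'n: "((\<lambda>x. z' (- x)) has_real_derivative w\<^sup>2 * z x) (at x within {-T..T})"
    if "x \<in> {-T..T}" for x
    using has_real_derivative_reflect_within[OF z, of x] has_real_derivative_reflect_within[OF z', of x] that
    by auto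
  \<comment> \<open>One argument for both parities: with \<open>\<psi> T = 0\<close> the condition
    at \<open>T\<close> only asks that the parity part of \<open>z\<close> vanish there, which the
    Dirichlet conditions give.\<close>
  have part: "z t + \<epsilon> * z (- t) = 0"
    if "parity_pair T (w\<^sup>2) \<epsilon> W \<phi> \<phi>' \<psi> \<psi>'" "\<psi> T = 0" "t \<in> {0..T}" for t \<epsilon> W \<phi> \<phi>' \<psi> \<psi>'
  proof -
    interpret parity_pair T "w\<^sup>2" \<epsilon> W \<phi> \<phi>' \<psi> \<psi>' by fact
    have "((\<lambda>s. \<phi> (min t s) * \<psi> (max t s) * 0) has_integral W * (z t + \<epsilon> * z (- t))) {0..T}"
    proof (rule parity_solution_representation[where v' = "\<lambda>x. z' x - \<epsilon> * z' (- x)"])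
      fix x assume x: "x \<in> {-T..T}"
      show "((\<lambda>x. z x + \<epsilon> * z (- x)) has_real_derivative z' x - \<epsilon> * z' (- x)) (at x within {-T..T})"
        by (rule derivative_eq_intros z[OF x] zn[OF x] refl)+ simp
      show "((\<lambda>x. z' x - \<epsilon> * z' (- x)) has_real_derivative 0 - \<epsilon> * w\<^sup>2 * (z x + \<epsilon> * z (- x))) (at x within {-T..T})"
        by (rule derivative_eq_intros z'[OF x] z'n[OF x] refl)+ (simp add: algebra_simps eps2)
    qed (use that bc in \<open>auto simp: algebra_simps eps2\<close>)
    then have "W * (z t + \<epsilon> * z (- t)) = 0" by simp
    then show ?thesis using W_nonzero by simp
  qed
  have z0: "z t = 0 \<and> z (- t) = 0" if "t \<in> {0..T}" for t
    using part[OF dirichlet_even_pair[OF assms(1,2) cos] _ that]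
      part[OF dirichlet_odd_pair[OF assms(1,2)] _ that] by simp
  have "z t = 0" if "t \<in> {-T..T}" for t
    using that z0[of t] z0[of "- t"] by (cases "0 \<le> t") auto
  then show False using nz by blast
qed

lemma smallest_dirichlet_eigenvalue:
  assumes "0 < T"
  shows "is_smallest_positive_dirichlet_eigenvalue T ((pi / (2 * T))\<^sup>2)"
  unfolding is_smallest_positive_dirichlet_eigenvalue_def
proof (intro conjI allI impI)
  define w where "w = pi / (2 * T)"
  have w: "0 < w" "w * T = pi / 2" using assms by (auto simp: w_def)
  show "0 < (pi / (2 * T))\<^sup>2" using assms by simp
  \<comment> \<open>The cosine is even, so reflecting its argument changes nothing, and it vanishes
    at both end points because \<open>w * T = pi / 2\<close>.\<close>
  have "dirichlet_solution T (w\<^sup>2) (\<lambda>x. cos (w * x))"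
    unfolding dirichlet_solution_def
    by (intro exI[of _ "\<lambda>x. - w * sin (w * x)"])
       (auto intro!: derivative_eq_intros simp: w power2_eq_square)
  then show "dirichlet_eigenvalue T ((pi / (2 * T))\<^sup>2)"
    unfolding dirichlet_eigenvalue_def w_def[symmetric]
    using assms by (intro exI conjI) (auto intro!: bexI[of _ 0])
  fix \<mu> :: real assume \<mu>: "0 < \<mu>" "dirichlet_eigenvalue T \<mu>"
  then have "pi / 2 \<le> sqrt \<mu> * T"
    by (intro dirichlet_eigenvalue_ge assms) auto
  then have "w \<le> sqrt \<mu>" using assms by (simp add: w_def field_simps)
  then have "w\<^sup>2 \<le> (sqrt \<mu>)\<^sup>2" using w by (intro power_mono) auto
  then show "(pi / (2 * T))\<^sup>2 \<le> \<mu>" using \<mu> by (simp add: w_def)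
qed

theorem theorem6p2:
  fixes T m :: real and G :: "real \<Rightarrow> real \<Rightarrow> real"
  assumes "0 < T"
    and "0 < m"
    and "\<forall>k::nat. m \<noteq> (real k * pi / T)\<^sup>2"
    and "is_greens_function T m G"
  shows "is_smallest_positive_dirichlet_eigenvalue T ((pi / (2 * T))\<^sup>2) \<and>
         ((\<forall>t\<in>{-T..T}. \<forall>s\<in>{-T..T}. 0 < G t s) \<longleftrightarrow> m \<in> {0<..<(pi / (2 * T))\<^sup>2})"
proof (rule conjI)
  define w where "w = sqrt m"
  have w: "0 < w" and m: "m = w\<^sup>2" using assms(2) by (auto simp: w_def)
  have G: "is_greens_function T (w\<^sup>2) G" using assms(4) m by simp
  have sin: "sin (w * T) \<noteq> 0"
  proof
    assume "sin (w * T) = 0"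
    then obtain i :: int where i: "w * T = of_int i * pi" by (auto simp: sin_zero_iff_int2)
    have "0 < of_int i * pi" unfolding i[symmetric] using w assms(1) by simp
    \<comment> \<open>Positivity lets the integer be read as a natural number, so that a zero of the
      sine contradicts the non-resonance assumption.\<close>
    then have "0 < i" by (simp add: zero_less_mult_iff)
    then have "w = real (nat i) * pi / T" using i assms(1) by (simp add: field_simps)
    then show False using assms(3) m by blast
  qed
  have "m < (pi / (2 * T))\<^sup>2 \<longleftrightarrow> w < pi / (2 * T)"
    unfolding m using w assms(1) by (simp flip: not_le)
  also have "\<dots> \<longleftrightarrow> w * T < pi / 2" using assms(1) by (simp add: field_simps)
  finally have iff: "m \<in> {0<..<(pi / (2 * T))\<^sup>2} \<longleftrightarrow> w * T < pi / 2"
    using assms(2) by simp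
  show "(\<forall>t\<in>{-T..T}. \<forall>s\<in>{-T..T}. 0 < G t s) \<longleftrightarrow> m \<in> {0<..<(pi / (2 * T))\<^sup>2}"
    unfolding iff
  proof
    assume pos: "\<forall>t\<in>{-T..T}. \<forall>s\<in>{-T..T}. 0 < G t s"
    show "w * T < pi / 2"
    proof (rule ccontr)
      assume "\<not> ?thesis"
      then obtain s where "s \<in> {-T..T}" "G 0 s \<le> 0"
        using greens_function_not_pos[OF assms(1) w _ sin G] by auto
      moreover have "0 \<in> {-T..T}" using assms(1) by simp
      ultimately show False using pos by fastforce
    qed
  qed (use greens_function_pos[OF assms(1) w _ G] in blast)
qed (rule smallest_dirichlet_eigenvalue[OF assms(1)])

end
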